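(* In the worst case, $\Omega(\sigma\, z_{no}\log_\sigma n)$ substring queries are necessary to reconstruct a string of length $n$ over an alphabet of size $\sigma$: for any adaptive reconstruction algorithm there are strings $S$ of length $n$ on which it asks $\Omega(\sigma\, z_{no}(S)\log_\sigma n)$ substring queries.
   Context: A substring oracle knows the hidden string $S$ and answers queries of the form "Is $s$ a substring of $S$?" with yes/no; an adaptive reconstruction algorithm chooses queries depending on previous answers and must determine $S$ exactly. $z_{no}(S)$ is the number of phrases of the Lempel–Ziv 1977 factorization of $S$ without overlaps: $S$ is parsed left to right into phrases, where each new phrase is either a single character not occurring earlier in $S$, or the longest string starting at the current position that also occurs in $S$ at an earlier starting position with that earlier occurrence not overlapping the phrase itself.
   Formalization: The bound is stated with universal constants for 2 ≤ σ ≤ n and n large; without σ ≤ n it fails uniformly: for σ = n², O(n²) queries always suffice, while σ·z_no·log_σ n is at least (n² log₂ n)/2. *)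

theory Defs
  imports Complex_Main "HOL-Library.Sublist"
begin

text \<open>Strings are lists of natural numbers; an alphabet of size sigma is {..<sigma}.\<close>

definition lz_phrase_len :: "nat list \<Rightarrow> nat \<Rightarrow> nat" where
  "lz_phrase_len S i =
     (if S ! i \<notin> set (take i S) then 1
      else (GREATEST l. \<exists>j. j + l \<le> i \<and> i + l \<le> length S \<and>
                             take l (drop j S) = take l (drop i S)))"

fun lz_start :: "nat list \<Rightarrow> nat \<Rightarrow> nat" where
  "lz_start S 0 = 0"
| "lz_start S (Suc k) = lz_start S k + lz_phrase_len S (lz_start S k)"

definition z_no :: "nat list \<Rightarrow> nat" where
  "z_no S = (LEAST k. length S \<le> lz_start S k)"

text \<open>Adaptive reconstruction algorithms as (finite) decision trees:
  Ask s t_yes t_no asks "is s a substring of S?".\<close>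
datatype qtree = Answer "nat list" | Ask "nat list" qtree qtree

fun run :: "qtree \<Rightarrow> nat list \<Rightarrow> nat list" where
  "run (Answer r) S = r"
| "run (Ask s ty tn) S = (if sublist s S then run ty S else run tn S)"

fun num_queries :: "qtree \<Rightarrow> nat list \<Rightarrow> nat" where
  "num_queries (Answer r) S = 0"
| "num_queries (Ask s ty tn) S = Suc (if sublist s S then num_queries ty S else num_queries tn S)"

end

theory Submission
  imports Defs "HOL-Library.FuncSet"
begin

text \<open>
  Consider strings D c(0) w(0) c(1) w(1) ... w(m-1) c(m), where the words w(i) are free words of
  length L over an alphabet Y, the contexts c(i) are fixed, and D contains every word over Y
  together with every piece of context that could surround it. If each context has only one
  possible position, then a query either has an answer independent of the words, or fits at one
  position only and hence asks for a conjunction of equations "this letter of this word is a".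
  An adversary that says no whenever possible loses one candidate for one letter per query, so
  m L (|Y| - 1) queries are needed, while the Lempel-Ziv parse has O(m) phrases as soon as D has
  that many, each w(i) being copied from D.

  For sigma at least 4 and sigma^7 at most n, runs of zeros between separators serve as contexts,
  with L proportional to log n / log sigma. For larger sigma the logarithm is bounded, and L = 1
  with single letters as contexts suffices. For sigma in {2, 3} counting the binary words is
  enough.
\<close>

section \<open>Parsings into letters and copies, and their bound on \<open>z_no\<close>\<close>

text \<open>A certificate for upper bounds on \<open>z_no\<close>: phrases need not be longest, a
  letter may be a repeated one, and a copy may be empty. The source of a copy lies wholly in the
  part already parsed, so it never overlaps the phrase.\<close>

inductive lz_cover :: "nat list \<Rightarrow> nat \<Rightarrow> bool" where
  empty: "lz_cover [] 0"
| letter: "lz_cover P k \<Longrightarrow> lz_cover (P @ [a]) (Suc k)"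
| copy: "lz_cover P k \<Longrightarrow> sublist u P \<Longrightarrow> lz_cover (P @ u) (Suc k)"

lemma lz_phrase_len_ge:
  assumes i: "i < length S" and l: "0 < l" "i + l \<le> length S"
    and j: "j + l \<le> i" and eq: "take l (drop j S) = take l (drop i S)"
  shows "l \<le> lz_phrase_len S i"
proof -
  have "S ! i = take l (drop i S) ! 0" using i l by simp
  also have "\<dots> = S ! j" using j i l by (simp flip: eq)
  finally have "S ! i = take i S ! j" using j l by simp
  moreover have "take i S ! j \<in> set (take i S)" using j l i by (intro nth_mem) simp
  ultimately have mem: "S ! i \<in> set (take i S)" by simp
  \<comment> \<open>The lengths competing in \<open>GREATEST\<close> are bounded by
    \<open>i\<close>, because the earlier occurrence has to end before position
    \<open>i\<close>.\<close>
  have "l \<le> (GREATEST l. \<exists>j. j + l \<le> i \<and> i + l \<le> length S \<and>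
                             take l (drop j S) = take l (drop i S))"
    by (rule Greatest_le_nat[where b = i]) (use l j eq in auto)
  then show ?thesis using mem by (simp add: lz_phrase_len_def)
qed

lemma lz_phrase_len_pos:
  assumes i: "i < length S"
  shows "1 \<le> lz_phrase_len S i"
proof (cases "S ! i \<in> set (take i S)")
  case False
  then show ?thesis by (simp add: lz_phrase_len_def)
next
  case True
  then obtain j where j: "j < i" "S ! j = S ! i" using i by (auto simp: in_set_conv_nth)
  have "take 1 (drop j S) = take 1 (drop i S)"
    using i j by (simp add: take_Suc_conv_app_nth)
  then show ?thesis using i j by (intro lz_phrase_len_ge[of i S 1 j]) auto
qed

text \<open>The greedy parsing is never behind any other parsing into letters and copies.\<close>

lemma lz_cover_le_lz_start:
  assumes "lz_cover P k"
  shows "length P \<le> lz_start (P @ Q) k"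
  using assms
\<comment> \<open>The remainder \<open>Q\<close> varies so that the hypothesis for a shorter prefix
  still concerns the parse of the same full string.\<close>
proof (induction arbitrary: Q rule: lz_cover.induct)
  case empty
  then show ?case by simp
next
  case (letter P k a)
  let ?S = "(P @ [a]) @ Q"
  let ?p = "lz_start ?S k"
  have "length P \<le> ?p" using letter.IH[of "a # Q"] by simp
  moreover have "1 \<le> lz_phrase_len ?S ?p" if "?p = length P"
    by (rule lz_phrase_len_pos) (simp add: that del: append_assoc)
  ultimately show ?case by (cases "?p = length P") auto
next
  case (copy P k u)
  let ?S = "(P @ u) @ Q"
  let ?p = "lz_start ?S k"
  have p: "length P \<le> ?p" using copy.IH[of "u @ Q"] by simp
  show ?case
  proof (cases "length (P @ u) \<le> ?p")
    case True
    then show ?thesis by simp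
  next
    case False
    \<comment> \<open>The greedy boundary falls \<open>d\<close> letters inside \<open>u\<close>.
      The rest of \<open>u\<close> recurs \<open>d\<close> letters into the source of the copy, so
      the next greedy phrase reaches at least the end of \<open>u\<close>.\<close>
    define d where "d = ?p - length P"
    have d: "?p = length P + d" "d < length u" using p False by (auto simp: d_def)
    obtain X Y where P: "P = X @ u @ Y" using copy.hyps(2) by (auto simp: sublist_def)
    have "length u - d \<le> lz_phrase_len ?S ?p"
    proof (rule lz_phrase_len_ge[where j = "length X + d"])
      show "?p < length ?S" using d by (simp del: append_assoc)
      have "take (length u - d) (drop (length X + d) ?S) = drop d u"
        using d(2) by (simp add: P)
      moreover have "take (length u - d) (drop ?p ?S) = drop d u"
        unfolding d(1) using d(2) by simp
      ultimately show "take (length u - d) (drop (length X + d) ?S) =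
        take (length u - d) (drop ?p ?S)" by simp
    qed (use d P in \<open>auto simp del: append_assoc\<close>)
    then show ?thesis using d by simp
  qed
qed

lemma z_no_le_lz_cover: "lz_cover S k \<Longrightarrow> z_no S \<le> k"
  unfolding z_no_def using lz_cover_le_lz_start[of S k "[]"] by (intro Least_le) simp

text \<open>Empty copies pad the count.\<close>

lemma lz_cover_mono:
  assumes "lz_cover P k" "k \<le> k'"
  shows "lz_cover P k'"
  using assms(2) by (induction rule: dec_induct) (use assms(1) lz_cover.copy[of P _ "[]"] in auto)

lemma lz_cover_letters: "lz_cover P k \<Longrightarrow> lz_cover (P @ u) (k + length u)"
proof (induction u arbitrary: P k)
  case (Cons a u)
  show ?case using Cons.IH[OF lz_cover.letter[OF Cons.prems, of a]] by simp
qed simp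

text \<open>Each copy can double the run, so padding with zeros costs only logarithmically many
  phrases.\<close>

lemma lz_cover_replicate: "R \<le> 2 ^ k \<Longrightarrow> lz_cover (replicate R a) (Suc k)"
proof (induction k arbitrary: R)
  case 0
  then consider "R = 0" | "R = 1" by fastforce
  then show ?case
    by cases (use lz_cover.letter[OF lz_cover.empty, of a] lz_cover_mono[OF lz_cover.empty] in auto)
next
  case (Suc k)
  show ?case
  proof (cases "R \<le> 2 ^ k")
    case True
    then show ?thesis using Suc.IH lz_cover_mono by (meson le_SucI order_refl)
  next
    case False
    define r where "r = R - 2 ^ k"
    have r: "R = 2 ^ k + r" "r \<le> 2 ^ k" using False Suc.prems by (auto simp: r_def)
    have "replicate (2 ^ k) a = replicate r a @ replicate (2 ^ k - r) a"
      using r by (simp flip: replicate_add)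
    then have "sublist (replicate r a) (replicate (2 ^ k) a)" by simp
    from lz_cover.copy[OF Suc.IH[OF order_refl] this] show ?thesis
      by (simp add: r(1) replicate_add)
  qed
qed

text \<open>Blocks are appended one by one. The initial \<open>P\<close> stays a prefix throughout,
  so every block may copy from it.\<close>

lemma lz_cover_concat_map:
  assumes "lz_cover P k"
    and "\<And>x P' k'. x \<in> set xs \<Longrightarrow> lz_cover P' k' \<Longrightarrow> prefix P P' \<Longrightarrow> lz_cover (P' @ g x) (k' + t)"
  shows "lz_cover (P @ concat (map g xs)) (k + length xs * t)"
  using assms(2)
proof (induction xs rule: rev_induct)
  case Nil
  then show ?case using assms(1) by simp
next
  case (snoc x xs)
  have "lz_cover ((P @ concat (map g xs)) @ g x) (k + length xs * t + t)"
    using snoc by (intro snoc.prems) auto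
  then show ?case by (simp add: algebra_simps)
qed

section \<open>The adversary argument\<close>

text \<open>The adversary keeps a set \<open>C i\<close> of candidate letters for every position
  \<open>i\<close>. The sum of the \<open>card (C i) - 1\<close> is a potential that drops by at
  most one per query and has to be zero when the tree answers.\<close>

lemma adversary_num_queries:
  fixes G :: "('i \<Rightarrow> nat) \<Rightarrow> nat list" and Y :: "nat set"
  assumes "finite I" "finite Y"
    and inj: "\<And>f f'. G f = G f' \<Longrightarrow> \<forall>i\<in>I. f i = f' i"
    and queries: "\<And>s. (\<forall>f\<in>Pi I (\<lambda>_. Y). \<not> sublist s (G f)) \<or>
      (\<exists>K\<subseteq>I. \<exists>a. \<forall>f\<in>Pi I (\<lambda>_. Y). sublist s (G f) \<longleftrightarrow> (\<forall>k\<in>K. f k = a k))"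
    and "\<And>i. i \<in> I \<Longrightarrow> C i \<subseteq> Y \<and> C i \<noteq> {}"
    and "\<And>f. f \<in> Pi I C \<Longrightarrow> run T (G f) = G f"
  shows "\<exists>f\<in>Pi I C. (\<Sum>i\<in>I. card (C i) - 1) \<le> num_queries T (G f)"
  using assms(5,6)
proof (induction T arbitrary: C)
  case (Answer r)
  define f where "f = (\<lambda>j. SOME y. y \<in> C j)"
  have f: "f \<in> Pi I C" using Answer.prems(1) by (auto simp: f_def some_in_eq)
  \<comment> \<open>A leaf returns one string, so two candidates left at \<open>i\<close> would
    yield two fillings with equal text, against \<open>inj\<close>.\<close>
  have "card (C i) - 1 = 0" if i: "i \<in> I" for i
  proof (rule ccontr)
    assume "card (C i) - 1 \<noteq> 0"
    then have "\<not> card (C i) \<le> Suc 0" by simp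
    then obtain a b where ab: "a \<in> C i" "b \<in> C i" "a \<noteq> b"
      by (metis card.infinite card_le_Suc0_iff_eq le0)
    have "f(i := a) \<in> Pi I C" "f(i := b) \<in> Pi I C" using f ab by auto
    then have "G (f(i := a)) = G (f(i := b))"
      using Answer.prems(2) run.simps(1) by metis
    then show False using inj[of "f(i := a)" "f(i := b)"] ab i by auto
  qed
  then have "(\<Sum>i\<in>I. card (C i) - 1) = 0" by simp
  then show ?case using f by (metis le0)
next
  case (Ask s ty tn)
  have sub: "f \<in> Pi I (\<lambda>_. Y)" if "f \<in> Pi I C" for f
    using that Ask.prems(1) by blast
  consider (no) "\<forall>f\<in>Pi I C. \<not> sublist s (G f)"
    | (yes) "\<forall>f\<in>Pi I C. sublist s (G f)"
    | (split) k y where "k \<in> I" "y \<in> C k" "2 \<le> card (C k)"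
        "\<forall>f\<in>Pi I C. sublist s (G f) \<longrightarrow> f k = y"
  proof -
    from queries[of s] consider "\<forall>f\<in>Pi I (\<lambda>_. Y). \<not> sublist s (G f)"
      | K a where "K \<subseteq> I" "\<forall>f\<in>Pi I (\<lambda>_. Y). sublist s (G f) \<longleftrightarrow> (\<forall>k\<in>K. f k = a k)"
      by blast
    then show thesis
    proof cases
      case 1
      then show ?thesis using no sub by blast
    next
      case 2
      then have iff: "\<forall>f\<in>Pi I C. sublist s (G f) \<longleftrightarrow> (\<forall>k\<in>K. f k = a k)"
        using sub by blast
      \<comment> \<open>If some required letter is excluded, the answer is no; if one is a candidate
        among others, it can be refused; if all are the only candidates left, the answer is yes. The
        last case includes empty \<open>K\<close>.\<close>
      consider k where "k \<in> K" "a k \<notin> C k"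
        | k where "k \<in> K" "a k \<in> C k" "2 \<le> card (C k)"
        | "\<forall>k\<in>K. a k \<in> C k \<and> \<not> 2 \<le> card (C k)"
        by blast
      then show ?thesis
      proof cases
        case (1 k)
        have "f k \<noteq> a k" if "f \<in> Pi I C" for f
          using that 1 \<open>K \<subseteq> I\<close> by (metis Pi_mem subsetD)
        then show ?thesis using no iff 1 by blast
      next
        case (2 k)
        then show ?thesis using split[of k "a k"] iff \<open>K \<subseteq> I\<close> by blast
      next
        case 3
        have "f k = a k" if "f \<in> Pi I C" "k \<in> K" for f k
        proof -
          have "finite (C k)" using Ask.prems(1) that(2) \<open>K \<subseteq> I\<close> \<open>finite Y\<close>
            by (meson finite_subset subsetD)
          moreover have "card (C k) \<le> Suc 0" using 3 that(2) by fastforce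
          moreover have "f k \<in> C k" "a k \<in> C k" using that 3 \<open>K \<subseteq> I\<close> by auto
          ultimately show ?thesis by (simp add: card_le_Suc0_iff_eq)
        qed
        then show ?thesis using yes iff by blast
      qed
    qed
  qed
  then show ?case
  proof cases
    case no
    then have "\<exists>f\<in>Pi I C. (\<Sum>i\<in>I. card (C i) - 1) \<le> num_queries tn (G f)"
      using Ask.prems by (intro Ask.IH(2)) force+
    then show ?thesis using no by (auto intro: le_SucI)
  next
    case yes
    then have "\<exists>f\<in>Pi I C. (\<Sum>i\<in>I. card (C i) - 1) \<le> num_queries ty (G f)"
      using Ask.prems by (intro Ask.IH(1)) force+
    then show ?thesis using yes by (auto intro: le_SucI)
  next
    case (split k y)
    \<comment> \<open>Discarding the candidate \<open>y\<close> at \<open>k\<close> forces the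
      answer no and costs exactly one unit of potential, paid for by this query.\<close>
    define C' where "C' = C(k := C k - {y})"
    have fin: "finite (C k)" using split(3) by (metis card.infinite not_numeral_le_zero)
    have card': "card (C' k) = card (C k) - 1" using split fin by (simp add: C'_def)
    have C': "C' i \<subseteq> C i \<and> C' i \<noteq> {}" if "i \<in> I" for i
    proof (cases "i = k")
      case True
      have "C' k \<noteq> {}" using card' split(3) by auto
      then show ?thesis using True by (auto simp: C'_def)
    next
      case False
      then show ?thesis using Ask.prems(1)[OF that] by (simp add: C'_def)
    qed
    have sub': "f \<in> Pi I C" if "f \<in> Pi I C'" for f using that C' by blast
    have no': "\<not> sublist s (G f)" if f: "f \<in> Pi I C'" for f
    proof -
      have "f k \<in> C' k" using f split(1) by blast
      then show ?thesis using split(4) sub'[OF f] by (auto simp: C'_def)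
    qed
    have "\<exists>f\<in>Pi I C'. (\<Sum>i\<in>I. card (C' i) - 1) \<le> num_queries tn (G f)"
    proof (rule Ask.IH(2))
      show "C' i \<subseteq> Y \<and> C' i \<noteq> {}" if "i \<in> I" for i
        using C'[OF that] Ask.prems(1)[OF that] by blast
      show "run tn (G f) = G f" if "f \<in> Pi I C'" for f
        using Ask.prems(2)[OF sub'[OF that]] no'[OF that] by simp
    qed
    then obtain f where f: "f \<in> Pi I C'" "(\<Sum>i\<in>I. card (C' i) - 1) \<le> num_queries tn (G f)"
      by blast
    have "(\<Sum>i\<in>I. card (C i) - 1) = (card (C k) - 1) + (\<Sum>i\<in>I - {k}. card (C i) - 1)"
      using \<open>finite I\<close> split(1) by (rule sum.remove)
    also have "(\<Sum>i\<in>I - {k}. card (C i) - 1) = (\<Sum>i\<in>I - {k}. card (C' i) - 1)"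
      by (rule sum.cong) (auto simp: C'_def)
    also have "card (C k) - 1 = Suc (card (C' k) - 1)" using card' split(3) by simp
    also have "Suc (card (C' k) - 1) + (\<Sum>i\<in>I - {k}. card (C' i) - 1)
        = Suc (\<Sum>i\<in>I. card (C' i) - 1)"
      using sum.remove[OF \<open>finite I\<close> split(1), of "\<lambda>i. card (C' i) - 1"] by simp
    finally have "(\<Sum>i\<in>I. card (C i) - 1) \<le> num_queries (Ask s ty tn) (G f)"
      using f no'[OF f(1)] by simp
    then show ?thesis using sub'[OF f(1)] by blast
  qed
qed

section \<open>Texts with a dictionary, contexts and free words\<close>

text \<open>\<open>Inl\<close> is a fixed letter and \<open>Inr\<close> a hole. With symbolic holes,
  matching a query at a given position becomes agreement on the holes it covers.\<close>

definition fill :: "(nat + 'i) list \<Rightarrow> ('i \<Rightarrow> nat) \<Rightarrow> nat list" where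
  "fill t f = map (case_sum id f) t"

lemma fill_eq_iff: "fill t f = fill t f' \<longleftrightarrow> (\<forall>k. Inr k \<in> set t \<longrightarrow> f k = f' k)"
  by (auto simp: fill_def split: sum.splits)

text \<open>\<open>D\<close> is the dictionary, and the hole \<open>(i, j)\<close> is letter
  \<open>j\<close> of the free word between \<open>c i\<close> and \<open>c (Suc i)\<close>.\<close>

definition slots :: "nat list \<Rightarrow> (nat \<Rightarrow> nat list) \<Rightarrow> nat \<Rightarrow> nat \<Rightarrow> (nat + nat \<times> nat) list" where
  "slots D c L m = map Inl D @
     concat (map (\<lambda>i. map Inl (c i) @ map (\<lambda>j. Inr (i, j)) [0..<L]) [0..<m]) @ map Inl (c m)"

lemma fill_slots:
  "fill (slots D c L m) f =
     D @ concat (map (\<lambda>i. c i @ map (\<lambda>j. f (i, j)) [0..<L]) [0..<m]) @ c m"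
  by (simp add: fill_def slots_def map_concat comp_def)

lemma holes_slots: "Inr k \<in> set (slots D c L m) \<longleftrightarrow> k \<in> {..<m} \<times> {..<L}"
  by (cases k) (auto simp: slots_def image_iff)

text \<open>An occurrence of \<open>s\<close> that does not cover all of \<open>c\<close> misses its
  first or its last letter, and so lies on one side of that letter.\<close>

lemma sublist_avoiding:
  assumes "sublist s (X @ c @ Y)" "\<not> sublist c s" "c \<noteq> []"
  shows "sublist s (X @ butlast c) \<or> sublist s (tl c @ Y)"
proof -
  obtain A B where eq: "X @ c @ Y = A @ s @ B" using assms(1) by (auto simp: sublist_def)
  consider "length A > length X" | "length A + length s < length (X @ c)"
    | "length A \<le> length X" "length (X @ c) \<le> length A + length s" by linarith
  then show ?thesis
  proof cases
    case 1
    have "tl c @ Y = drop (Suc (length X)) (X @ c @ Y)" using assms(3) by (cases c) auto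
    also have "\<dots> = drop (Suc (length X)) A @ s @ B" using 1 by (simp add: eq)
    finally show ?thesis by (metis sublist_appendI)
  next
    case 2
    have "X @ butlast c = take (length (X @ c) - 1) (X @ c @ Y)"
      using assms(3) by (cases c rule: rev_cases) simp_all
    also have "\<dots> = A @ s @ take (length (X @ c) - 1 - length A - length s) B"
      using 2 by (simp add: eq)
    finally show ?thesis by (metis sublist_appendI)
  next
    case 3
    have "c = take (length c) (drop (length X - length A) (drop (length A) (X @ c @ Y)))"
      using 3 by simp
    also have "\<dots> = take (length c) (drop (length X - length A) s)"
      using 3 by (simp add: eq)
    finally have "sublist c s" by (metis sublist_drop sublist_order.order.trans sublist_take)
    then show ?thesis using assms(2) by simp
  qed
qed

text \<open>The two hypotheses yield the dichotomy of \<open>adversary_num_queries\<close>: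
  \<open>dict\<close> makes the answer to a query containing no context the same for all fillings,
  and \<open>unique\<close> fixes the position of a query containing one.\<close>

lemma slots_num_queries:
  fixes D :: "nat list" and Y :: "nat set" and L m :: nat
  defines "F \<equiv> Pi ({..<m} \<times> {..<L}) (\<lambda>_. Y)"
  assumes "finite Y" "Y \<noteq> {}"
    and c: "\<And>i. i \<le> m \<Longrightarrow> c i \<noteq> []"
    and unique: "\<And>f f' i X Z X' Z'. f \<in> F \<Longrightarrow> f' \<in> F \<Longrightarrow> i \<le> m \<Longrightarrow>
      fill (slots D c L m) f = X @ c i @ Z \<Longrightarrow> fill (slots D c L m) f' = X' @ c i @ Z' \<Longrightarrow>
      length X = length X'"
    and dict: "\<And>i w. i < m \<Longrightarrow> length w = L \<Longrightarrow> set w \<subseteq> Y \<Longrightarrow>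
      sublist (tl (c i) @ w @ butlast (c (Suc i))) D"
    and T: "\<And>f. f \<in> F \<Longrightarrow> run T (fill (slots D c L m) f) = fill (slots D c L m) f"
  shows "\<exists>f\<in>F. m * L * (card Y - 1) \<le> num_queries T (fill (slots D c L m) f)"
proof -
  let ?I = "{..<m} \<times> {..<L}"
  define t where "t = slots D c L m"
  define word where "word f i = map (\<lambda>j. f (i, j)) [0..<L]" for f :: "nat \<times> nat \<Rightarrow> nat" and i
  define pre where "pre f i = D @ concat (map (\<lambda>i. c i @ word f i) [0..<i])" for f i
  have fill_t: "fill t f = pre f m @ c m" for f
    by (simp add: t_def fill_slots pre_def word_def)
  have pre_Suc: "pre f (Suc i) = pre f i @ c i @ word f i" for f i
    by (simp add: pre_def)
  have D_fill: "sublist s (fill t f)" if "sublist s D" for s f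
    using that by (simp add: fill_t pre_def sublist_appendI sublist_append)
  have dict': "sublist (tl (c i) @ word f i @ butlast (c (Suc i))) D" if "f \<in> F" "i < m" for f i
    using that by (intro dict) (auto simp: word_def F_def)
  \<comment> \<open>Going back through the contexts with \<open>sublist_avoiding\<close>, each piece
    between two neighbouring contexts is absorbed by \<open>D\<close>. What remains is one of the
    fixed texts \<open>D @ butlast (c 0)\<close>, \<open>D\<close> and \<open>tl (c m)\<close>,
    which all occur in every filling.\<close>
  have free: "sublist s (fill t f')"
    if f: "f \<in> F" and s: "sublist s (fill t f)" and av: "\<forall>i\<le>m. \<not> sublist (c i) s" for s f f'
  proof -
    have "sublist s (D @ butlast (c 0)) \<or> sublist s D"
      if "sublist s (pre f k @ butlast (c k))" "k \<le> m" for k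
      using that
    proof (induction k)
      case 0
      then show ?case by (simp add: pre_def)
    next
      case (Suc k)
      have "sublist s (pre f k @ c k @ word f k @ butlast (c (Suc k)))"
        using Suc.prems by (simp add: pre_Suc)
      then have "sublist s (pre f k @ butlast (c k)) \<or>
          sublist s (tl (c k) @ word f k @ butlast (c (Suc k)))"
        using av c Suc.prems(2) by (intro sublist_avoiding) auto
      then show ?case
        using Suc dict'[OF f, of k] sublist_order.order.trans by (metis Suc_leD Suc_le_lessD)
    qed
    moreover have "sublist s (pre f m @ butlast (c m)) \<or> sublist s (tl (c m) @ [])"
      using av c s by (intro sublist_avoiding) (auto simp: fill_t)
    ultimately consider "sublist s (D @ butlast (c 0))" | "sublist s D" | "sublist s (tl (c m))"
      by auto
    then show ?thesis
    proof cases
      case 1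
      have "prefix (D @ butlast (c 0)) (fill t f')"
      proof (cases m)
        case 0
        then show ?thesis by (simp add: fill_t pre_def prefix_def)
            (metis append_butlast_last_id c le0)
      next
        case (Suc m')
        have "prefix (D @ c 0) (fill t f')"
          using Suc by (simp add: fill_t pre_def upt_conv_Cons del: upt_Suc)
        then show ?thesis
          by (metis append_butlast_last_id append_assoc c le0 prefix_def)
      qed
      then show ?thesis using 1 prefix_imp_sublist sublist_order.order.trans by blast
    next
      case 2
      then show ?thesis by (rule D_fill)
    next
      case 3
      have "sublist (tl (c m)) (fill t f')"
        unfolding fill_t by (metis sublist_append_leftI sublist_order.order.trans sublist_tl sublist_order.order.refl)
      then show ?thesis using 3 sublist_order.order.trans by blast
    qed
  qed
  have "\<exists>f\<in>Pi ?I (\<lambda>_. Y). (\<Sum>i\<in>?I. card Y - 1) \<le> num_queries T (fill t f)"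
  proof (rule adversary_num_queries)
    show "\<forall>i\<in>?I. f i = f' i" if "fill t f = fill t f'" for f f'
      using that by (simp add: fill_eq_iff t_def holes_slots)
    show "(\<forall>f\<in>Pi ?I (\<lambda>_. Y). \<not> sublist s (fill t f)) \<or>
      (\<exists>K\<subseteq>?I. \<exists>a. \<forall>f\<in>Pi ?I (\<lambda>_. Y). sublist s (fill t f) \<longleftrightarrow> (\<forall>k\<in>K. f k = a k))" for s
    proof (cases "(\<forall>f\<in>F. \<not> sublist s (fill t f)) \<or> (\<forall>f\<in>F. sublist s (fill t f))")
      \<comment> \<open>A query always answered yes is the conjunction over the empty
        \<open>K\<close>.\<close>
      case True
      then show ?thesis
        unfolding F_def by (metis (no_types, lifting) empty_iff empty_subsetI)
    next
      case False
      then obtain f0 where f0: "f0 \<in> F" "sublist s (fill t f0)" by blast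
      then obtain i where i: "i \<le> m" "sublist (c i) s" using free False by blast
      then obtain A B where AB: "s = A @ c i @ B" by (auto simp: sublist_def)
      obtain X Z where XZ: "fill t f0 = X @ s @ Z" using f0 by (auto simp: sublist_def)
      \<comment> \<open>\<open>u\<close> is the part of the template that \<open>s\<close> covers in
        the filling \<open>f0\<close>. The context inside \<open>s\<close> starts at offset
        \<open>length A\<close>, so its unique position carries over to \<open>s\<close>, and
        \<open>s\<close> can match another filling only on this same part.\<close>
      define u where "u = take (length s) (drop (length X) t)"
      have u: "take (length s) (drop (length X) (fill t f)) = fill u f" for f
        by (simp add: u_def fill_def take_map drop_map)
      have s: "s = fill u f0" by (simp add: XZ flip: u)
      have iff: "sublist s (fill t f) \<longleftrightarrow> fill u f = fill u f0" if f: "f \<in> F" for f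
      proof
        assume "sublist s (fill t f)"
        then obtain X' Z' where XZ': "fill t f = X' @ s @ Z'" by (auto simp: sublist_def)
        have "length (X' @ A) = length (X @ A)"
          by (rule unique[OF f f0(1) i(1), of _ "B @ Z'" _ "B @ Z"])
            (use XZ XZ' AB in \<open>auto simp: t_def\<close>)
        then show "fill u f = fill u f0" using s u[of f] by (simp add: XZ')
      next
        assume "fill u f = fill u f0"
        then show "sublist s (fill t f)"
          by (metis s u sublist_drop sublist_order.order.trans sublist_take)
      qed
      let ?K = "{k. Inr k \<in> set u}"
      have "set u \<subseteq> set t" unfolding u_def by (meson in_set_dropD in_set_takeD subsetI)
      then have "?K \<subseteq> ?I" using holes_slots[of _ D c L m] by (auto simp: t_def)
      moreover have "\<forall>f\<in>F. sublist s (fill t f) \<longleftrightarrow> (\<forall>k\<in>?K. f k = f0 k)"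
        using iff by (auto simp: fill_eq_iff)
      ultimately show ?thesis unfolding F_def by blast
    qed
  qed (use assms in \<open>auto simp: t_def F_def\<close>)
  then show ?thesis by (simp add: F_def t_def)
qed

text \<open>A word costs a single copy from \<open>D\<close>, and \<open>t\<close> is the price of a
  context, which may itself copy from \<open>D\<close>.\<close>

lemma lz_cover_slots:
  assumes "lz_cover D k"
    and "\<And>i P' k'. i \<le> m \<Longrightarrow> lz_cover P' k' \<Longrightarrow> prefix D P' \<Longrightarrow> lz_cover (P' @ c i) (k' + t)"
    and "\<And>w. length w = L \<Longrightarrow> set w \<subseteq> Y \<Longrightarrow> sublist w D"
    and "f \<in> Pi ({..<m} \<times> {..<L}) (\<lambda>_. Y)"
  shows "lz_cover (fill (slots D c L m) f) (k + m * Suc t + t)"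
proof -
  let ?w = "\<lambda>i. map (\<lambda>j. f (i, j)) [0..<L]"
  have "lz_cover (D @ concat (map (\<lambda>i. c i @ ?w i) [0..<m])) (k + length [0..<m] * Suc t)"
    using assms(1)
  proof (rule lz_cover_concat_map)
    fix i P' k' assume i: "i \<in> set [0..<m]" and P: "lz_cover P' k'" "prefix D P'"
    have "sublist (?w i) D" using assms(4) i by (intro assms(3)) auto
    moreover have "sublist D (P' @ c i)"
      using P(2) by (meson prefix_imp_sublist sublist_append_rightI sublist_order.order.trans)
    ultimately have "sublist (?w i) (P' @ c i)" by (rule sublist_order.order.trans)
    moreover have "lz_cover (P' @ c i) (k' + t)" using i P by (intro assms(2)) auto
    ultimately show "lz_cover (P' @ c i @ ?w i) (k' + Suc t)"
      using lz_cover.copy by fastforce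
  qed
  then have "lz_cover ((D @ concat (map (\<lambda>i. c i @ ?w i) [0..<m])) @ c m) (k + m * Suc t + t)"
    by (intro assms(2)) auto
  then show ?thesis by (simp add: fill_slots)
qed

lemma length_fill: "length (fill t f) = length t"
  by (simp add: fill_def)

lemma length_slots: "length (slots D c L m) = length D + (\<Sum>i<m. length (c i) + L) + length (c m)"
  by (simp add: slots_def length_concat comp_def interv_sum_list_conv_sum_set_nat atLeast0LessThan)

lemma concat_interleave_split:
  assumes "i \<le> m"
  shows "concat (map (\<lambda>j. c j @ w j) [0..<m]) @ c m =
    concat (map (\<lambda>j. c j @ w j) [0..<i]) @ c i @
      (if i < m then w i @ concat (map (\<lambda>j. c j @ w j) [Suc i..<m]) @ c m else [])"
proof (cases "i < m")
  case True
  then have "[0..<m] = [0..<i] @ i # [Suc i..<m]"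
    using upt_add_eq_append[of 0 i "m - i"] by (simp add: upt_conv_Cons)
  then show ?thesis using True by simp
qed (use assms in simp)

lemma set_fill_slots:
  assumes "f \<in> Pi ({..<m} \<times> {..<L}) (\<lambda>_. Y)"
  shows "set (fill (slots D c L m) f) \<subseteq> set D \<union> (\<Union>i\<le>m. set (c i)) \<union> Y"
  using assms by (fastforce simp: fill_slots)

section \<open>Large alphabets: single letters as contexts\<close>

text \<open>With one-letter contexts nothing is left of \<open>tl (c i)\<close> and
  \<open>butlast (c (Suc i))\<close>, so listing the letters of \<open>Y\<close> once suffices as
  dictionary. Both the query bound per slot and the number of slots are then of order
  \<open>h\<close>.\<close>

lemma obtain_letter_contexts:
  fixes h n :: nat
  assumes h: "0 < h" "3 * h + 1 \<le> n" and n: "n \<le> 2 ^ k"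
    and T: "\<And>S. length S = n \<Longrightarrow> set S \<subseteq> {..2 * h + 1} \<Longrightarrow> run T S = S"
  obtains S where "length S = n" "set S \<subseteq> {..2 * h + 1}"
    "h * (h - 1) \<le> num_queries T S" "z_no S \<le> k + 3 * h + 2"
proof -
  \<comment> \<open>The zeros fill up to length \<open>n\<close> what the \<open>h\<close>
    dictionary letters, the \<open>h\<close> pairs of context and word, and the last context leave
    free.\<close>
  define R where "R = n - (3 * h + 1)"
  define D where "D = replicate R 0 @ [1..<Suc h]"
  define c where "c i = [Suc h + i]" for i
  define Y where "Y = {1..<Suc h}"
  let ?t = "slots D c 1 h"
  let ?F = "Pi ({..<h} \<times> {..<1::nat}) (\<lambda>_. Y)"
  have len: "length ?t = n" using h by (simp add: length_slots D_def c_def R_def)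
  have set: "set (fill ?t f) \<subseteq> {..2 * h + 1}" if "f \<in> ?F" for f
    by (rule order.trans[OF set_fill_slots[OF that]]) (auto simp: D_def c_def Y_def)
  have dict: "sublist w D" if w: "length w = 1" "set w \<subseteq> Y" for w
  proof -
    obtain a where a: "w = [a]" using w(1) by (auto simp: length_Suc_conv)
    then have "a \<in> set D" using w by (auto simp: D_def Y_def)
    then show ?thesis by (metis a append_Cons append_Nil in_set_conv_decomp sublist_appendI)
  qed
  have "\<exists>f\<in>?F. h * 1 * (card Y - 1) \<le> num_queries T (fill ?t f)"
  proof (rule slots_num_queries)
    fix f f' i X Z X' Z'
    assume f: "f \<in> ?F" "f' \<in> ?F" and i: "i \<le> h"
      and eq: "fill ?t f = X @ c i @ Z" "fill ?t f' = X' @ c i @ Z'"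
    \<comment> \<open>The letter \<open>Suc h + i\<close> is used by no word, by no other context
      and not by \<open>D\<close>, so it occurs once.\<close>
    have pos: "length X = length D + (\<Sum>j<i. 2)"
      if f: "f \<in> ?F" and eq: "fill ?t f = X @ c i @ Z" for f X Z
    proof -
      let ?w = "\<lambda>j. map (\<lambda>l. f (j, l)) [0..<1]"
      let ?P = "D @ concat (map (\<lambda>j. c j @ ?w j) [0..<i])"
      let ?Q = "if i < h then ?w i @ concat (map (\<lambda>j. c j @ ?w j) [Suc i..<h]) @ c h else []"
      have fY: "f (j, 0) < Suc (h + i)" if "j < h" for j
      proof -
        have "f (j, 0) \<in> Y" using f that by auto
        then show ?thesis by (simp add: Y_def)
      qed
      have "?P @ (Suc h + i) # ?Q = X @ (Suc h + i) # Z"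
        using concat_interleave_split[OF i, of c ?w] eq by (simp add: fill_slots c_def)
      moreover have "Suc h + i \<notin> set ?P"
        using i fY[OF less_le_trans[OF _ i]] by (force simp: D_def c_def)
      moreover have "Suc h + i \<notin> set ?Q"
        using i fY by (force simp: c_def)
      ultimately have "X = ?P" using append_Cons_eq_iff[of "Suc h + i" ?P ?Q X Z] by blast
      then show ?thesis
        by (simp add: c_def length_concat comp_def interv_sum_list_conv_sum_set_nat)
    qed
    show "length X = length X'" using pos[OF f(1) eq(1)] pos[OF f(2) eq(2)] by simp
  next
    show "run T (fill ?t f) = fill ?t f" if "f \<in> ?F" for f
      using T[OF _ set[OF that]] len by (simp add: length_fill)
  qed (use h dict in \<open>auto simp: c_def Y_def\<close>)
  then obtain f where f: "f \<in> ?F" "h * (h - 1) \<le> num_queries T (fill ?t f)"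
    by (auto simp: Y_def)
  have "R \<le> 2 ^ k" using n by (simp add: R_def)
  then have "lz_cover D (Suc k + h)"
    using lz_cover_letters[OF lz_cover_replicate, of R k 0 "[1..<Suc h]"]
    by (simp add: D_def del: upt_Suc)
  then have "lz_cover (fill ?t f) (Suc k + h + h * Suc 1 + 1)"
    by (rule lz_cover_slots) (use f dict lz_cover.letter in \<open>auto simp: c_def\<close>)
  then have "z_no (fill ?t f) \<le> k + 3 * h + 2"
    using z_no_le_lz_cover by fastforce
  then show thesis using that[of "fill ?t f"] f set len by (simp add: length_fill)
qed

section \<open>Smaller alphabets: runs of zeros as contexts\<close>

text \<open>Since no segment contains the separator, the text determines its segments; searching for
  a word framed by separators becomes searching a list.\<close>

lemma segment_decomp:
  assumes "concat (map (\<lambda>u. u @ [x]) us) = X @ x # v @ x # Z"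
    and "\<And>u. u \<in> set us \<Longrightarrow> x \<notin> set u" and "x \<notin> set v"
  obtains us1 us2 where "us = us1 @ v # us2" "X @ [x] = concat (map (\<lambda>u. u @ [x]) us1)"
proof -
  have first: "A = B \<and> C = E" if "A @ x # C = B @ x # E" "x \<notin> set A" "x \<notin> set B"
    for A B C E :: "'a list"
    using that by (auto simp: append_eq_append_conv2 append_eq_Cons_conv Cons_eq_append_conv)
  have "\<exists>us1 us2. us = us1 @ v # us2 \<and> X @ [x] = concat (map (\<lambda>u. u @ [x]) us1)"
    using assms(1,2)
  proof (induction us arbitrary: X)
    case (Cons u us)
    let ?rest = "concat (map (\<lambda>u. u @ [x]) us)"
    have eq: "u @ x # ?rest = X @ x # v @ x # Z" using Cons.prems(1) by simp
    have u: "x \<notin> set u" using Cons.prems(2) by simp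
    show ?case
    proof (cases "x \<in> set X")
      case False
      then have X: "X = u" and rest: "?rest = v @ x # Z" using first[OF eq u] by auto
      then obtain u' us' where us: "us = u' # us'" by (cases us) auto
      have "u' = v" using first[of u' "concat (map (\<lambda>u. u @ [x]) us')" v Z]
          rest Cons.prems(2) assms(3) us by auto
      then show ?thesis using X us by (intro exI[of _ "[u]"] exI[of _ us']) auto
    next
      case True
      then obtain X1 X2 where X: "X = X1 @ x # X2" "x \<notin> set X1"
        by (meson split_list_first)
      then have "u = X1" "?rest = X2 @ x # v @ x # Z"
        using first[of u ?rest X1 "X2 @ x # v @ x # Z"] eq u by auto
      moreover obtain us1 us2 where "us = us1 @ v # us2" "X2 @ [x] = concat (map (\<lambda>u. u @ [x]) us1)"
        using Cons.IH[of X2] Cons.prems(2) calculation(2) by auto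
      ultimately show ?thesis using X by (intro exI[of _ "u # us1"] exI[of _ us2]) auto
    qed
  qed simp
  then show thesis using that by blast
qed

text \<open>Moves every separator from the front of a piece to its end, the form that
  \<open>segment_decomp\<close> expects.\<close>

lemma concat_separators:
  "concat (map (\<lambda>y. x # a y @ x # b y) ys) @ x # Z =
    x # concat (map (\<lambda>u. u @ [x]) (concat (map (\<lambda>y. [a y, b y]) ys))) @ Z"
  by (induction ys) auto

lemma sublist_replicate: "k \<le> n \<Longrightarrow> sublist (replicate k a) (replicate n a)"
  by (metis le_add_diff_inverse replicate_add sublist_append_rightI)

text \<open>The letter 1 is the separator; a run of zeros between two separators names the slot.\<close>

definition run_ctx :: "nat \<Rightarrow> nat list" where
  "run_ctx i = 1 # replicate (Suc i) 0 @ [1]"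

text \<open>Every word is framed by separators and has zeros on both sides, to match the pieces of
  context that may surround it. \<open>R\<close> also serves as padding to the prescribed
  length.\<close>

definition run_dict :: "nat \<Rightarrow> nat \<Rightarrow> nat list list \<Rightarrow> nat list" where
  "run_dict R M ws = replicate R 0 @ concat (map (\<lambda>w. 1 # w @ 1 # replicate M 0) ws)"

text \<open>Cut at the letters 1, the text has \<open>Suc i\<close> zeros as a segment only once:
  the runs in the dictionary are longer, the other contexts have other lengths, and a nonempty word
  over \<open>Y\<close> is not made of zeros.\<close>

lemma run_ctx_unique:
  assumes "m + 1 < R" "m + 1 < M" "0 < L" "i \<le> m"
    and ws: "\<And>w. w \<in> set ws \<Longrightarrow> length w = L \<and> set w \<subseteq> Y" and Y: "Y \<inter> {0, 1} = {}"
    and f: "f \<in> Pi ({..<m} \<times> {..<L}) (\<lambda>_. Y)"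
    and eq: "fill (slots (run_dict R M ws) run_ctx L m) f = X @ run_ctx i @ Z"
  shows "length X = length (run_dict R M ws) + (\<Sum>j<i. length (run_ctx j) + L)"
proof -
  define word where "word = (\<lambda>j. map (\<lambda>l. f (j, l)) [0..<L])"
  define zs where "zs j = replicate (Suc j) (0::nat)" for j
  define seps where "seps = (\<lambda>us. concat (map (\<lambda>u. u @ [1::nat]) us))"
  \<comment> \<open>The segments of the dictionary, then \<open>us1\<close> for all those before the
    run \<open>zs i\<close> and \<open>us2\<close> for all those after it.\<close>
  define us0 where "us0 = replicate R 0 # concat (map (\<lambda>w. [w, replicate M 0]) ws)"
  define us1 where "us1 = us0 @ concat (map (\<lambda>j. [zs j] @ [word j]) [0..<i])"
  define us2 where "us2 = (if i < m then [word i] @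
    concat (map (\<lambda>j. [zs j] @ [word j]) [Suc i..<m]) @ [zs m] else [])"
  have word: "set (word j) \<subseteq> Y" "length (word j) = L" if "j < m" for j
    using f that by (auto simp: word_def)
  have zs_neq: "zs i \<noteq> w" if "length w = L" "set w \<subseteq> Y" for w
  proof
    assume "zs i = w"
    then have "0 \<in> set w" by (auto simp: zs_def)
    then show False using that Y by auto
  qed
  have "fill (slots (run_dict R M ws) run_ctx L m) f
      = seps (us0 @ concat (map (\<lambda>j. [zs j] @ [word j]) [0..<m]) @ [zs m])"
    using concat_separators[of 1 zs word "[0..<m]" "zs m @ [1]"]
      concat_separators[of 1 "\<lambda>w. w" "\<lambda>_. replicate M 0" ws]
    by (simp add: fill_slots run_dict_def run_ctx_def seps_def us0_def zs_def word_def)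
  also have "\<dots> = seps (us1 @ zs i # us2)"
    using concat_interleave_split[OF \<open>i \<le> m\<close>, of "\<lambda>j. [zs j]" "\<lambda>j. [word j]"]
    by (simp add: us1_def us2_def)
  finally have fill_eq: "fill (slots (run_dict R M ws) run_ctx L m) f = seps (us1 @ zs i # us2)" .
  then have sep_eq: "concat (map (\<lambda>u. u @ [1]) (us1 @ zs i # us2)) = X @ 1 # zs i @ 1 # Z"
    using eq by (simp add: seps_def run_ctx_def zs_def)
  have us0: "u \<in> {replicate R 0, replicate M 0} \<or> u \<in> set ws" if "u \<in> set us0" for u
    using that by (auto simp: us0_def)
  have us1: "u \<in> set us0 \<or> (\<exists>j<i. u = zs j \<or> u = word j)" if "u \<in> set us1" for u
    using that by (auto simp: us1_def)
  have us2: "(\<exists>j>i. u = zs j) \<or> (\<exists>j<m. u = word j)" if "u \<in> set us2" for u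
    using that by (auto simp: us2_def Suc_le_eq split: if_splits)
  have no_sep: "1 \<notin> set u" if "u \<in> set (us1 @ zs i # us2)" for u
  proof -
    have "1 \<notin> set (word j)" if "j < m" for j using word[OF that] Y by auto
    moreover have "1 \<notin> set (zs j)" for j by (simp add: zs_def)
    moreover have "1 \<notin> set w" if "w \<in> set ws" for w using ws[OF that] Y by auto
    moreover have "u \<in> {replicate R 0, replicate M 0} \<union> set ws \<union> range zs \<or> (\<exists>j<m. u = word j)"
    proof -
      have "\<exists>j<m. u = word j" if "\<exists>j<i. u = word j"
        using that \<open>i \<le> m\<close> less_le_trans by blast
      then show ?thesis using that us0[of u] us1[of u] us2[of u] by auto
    qed
    ultimately show ?thesis by auto
  qed
  have "zs i \<notin> set us1"
  proof
    assume "zs i \<in> set us1"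
    then consider "zs i \<in> {replicate R 0, replicate M 0}" | "zs i \<in> set ws"
      | j where "j < i" "zs i = zs j \<or> zs i = word j" using us0 us1 by blast
    then show False
    proof cases
      case 1
      then show ?thesis using assms by (auto simp: zs_def simp del: replicate_Suc)
    next
      case 2
      then show ?thesis using ws zs_neq by blast
    next
      case 3
      then show ?thesis using word[of j] zs_neq[of "word j"] \<open>i \<le> m\<close>
        by (auto simp: zs_def simp del: replicate_Suc)
    qed
  qed
  moreover have "zs i \<notin> set us2"
  proof
    assume "zs i \<in> set us2"
    then obtain j where "i < j \<and> zs i = zs j \<or> j < m \<and> zs i = word j" using us2 by blast
    then show False using word[of j] zs_neq[of "word j"]
      by (auto simp: zs_def simp del: replicate_Suc)
  qed
  \<comment> \<open>As \<open>zs i\<close> is in neither \<open>us1\<close> nor \<open>us2\<close>,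
    the two decompositions coincide, which determines \<open>X\<close>.\<close>
  moreover obtain vs1 vs2 where "us1 @ zs i # us2 = vs1 @ zs i # vs2" "X @ [1] = seps vs1"
    using segment_decomp[OF sep_eq no_sep] by (auto simp: zs_def seps_def)
  ultimately have "X @ [1] = seps us1" by (simp add: append_Cons_eq_iff)
  also have "\<dots> = run_dict R M ws @ concat (map (\<lambda>j. run_ctx j @ word j) [0..<i]) @ [1]"
    using concat_separators[of 1 zs word "[0..<i]" "[]"]
      concat_separators[of 1 "\<lambda>w. w" "\<lambda>_. replicate M 0" ws]
    by (simp add: us1_def us0_def seps_def run_dict_def run_ctx_def zs_def)
  finally have "X = run_dict R M ws @ concat (map (\<lambda>j. run_ctx j @ word j) [0..<i])" by simp
  then show ?thesis
    by (simp add: length_concat comp_def interv_sum_list_conv_sum_set_nat word_def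
        atLeast0LessThan)
qed

lemma sublist_run_dict:
  assumes "w \<in> set ws" "a \<le> R" "a \<le> M" "b \<le> M"
  shows "sublist (replicate a 0 @ 1 # w @ 1 # replicate b 0) (run_dict R M ws)"
proof -
  let ?g = "\<lambda>w. 1 # w @ 1 # replicate M (0::nat)"
  obtain A B where ws: "ws = A @ w # B" using assms(1) by (meson split_list)
  have zeros: "\<exists>Q. replicate n (0::nat) = Q @ replicate a 0" if "a \<le> n" for n
    using that by (metis le_add_diff_inverse2 replicate_add)
  \<comment> \<open>The zeros before \<open>w\<close> come from the padding if \<open>w\<close> is
    the first word, and from the run after the preceding word otherwise.\<close>
  obtain P where P: "replicate R 0 @ concat (map ?g A) = P @ replicate a 0"
  proof (cases A rule: rev_cases)
    case Nil
    then show ?thesis using that zeros[OF assms(2)] by auto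
  next
    case (snoc A' v)
    then show ?thesis using that zeros[OF assms(3)] by auto
  qed
  have "replicate M (0::nat) = replicate b 0 @ replicate (M - b) 0"
    using assms(4) by (simp flip: replicate_add)
  then have "run_dict R M ws = P @ (replicate a 0 @ 1 # w @ 1 # replicate b 0) @
      (replicate (M - b) 0 @ concat (map ?g B))"
    using P by (simp add: run_dict_def ws)
  then show ?thesis by (metis sublist_appendI)
qed

text \<open>An entry costs \<open>L + 2\<close> single letters for the word and its separators, and
  one copy of \<open>M\<close> zeros out of the padding.\<close>

lemma lz_cover_run_dict:
  assumes "R \<le> 2 ^ k" "M \<le> R" "\<And>w. w \<in> set ws \<Longrightarrow> length w = L"
  shows "lz_cover (run_dict R M ws) (Suc k + length ws * (L + 3))"
  unfolding run_dict_def
proof (rule lz_cover_concat_map)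
  show "lz_cover (replicate R 0) (Suc k)" using assms(1) by (rule lz_cover_replicate)
  fix w P' k'
  assume w: "w \<in> set ws" and P': "lz_cover P' k'" "prefix (replicate R 0) P'"
  have "lz_cover (P' @ 1 # w @ [1]) (k' + length (1 # w @ [1]))"
    using P'(1) by (rule lz_cover_letters)
  moreover have "sublist (replicate M 0) (P' @ 1 # w @ [1])"
    using P'(2) sublist_replicate[OF assms(2), of 0]
    by (meson prefix_imp_sublist sublist_append_rightI sublist_order.order.trans)
  ultimately have "lz_cover ((P' @ 1 # w @ [1]) @ replicate M 0) (Suc (k' + length (1 # w @ [1])))"
    by (rule lz_cover.copy)
  then show "lz_cover (P' @ 1 # w @ 1 # replicate M 0) (k' + (L + 3))"
    using assms(3)[OF w] by (simp add: eval_nat_numeral)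
qed

text \<open>The dictionary of all \<open>(\<sigma> - 2) ^ L\<close> words costs about
  \<open>L\<close> phrases per word. Taking \<open>m\<close> slots, with \<open>m\<close> equal to
  this product, makes its cost proportional to that of the slots.\<close>

lemma obtain_run_contexts:
  fixes \<sigma> L n k :: nat
  defines "m \<equiv> L * (\<sigma> - 2) ^ L"
  assumes \<sigma>: "4 \<le> \<sigma>" and L: "0 < L" and n: "10 * (m * m) \<le> n" "n \<le> 2 ^ k"
    and T: "\<And>S. length S = n \<Longrightarrow> set S \<subseteq> {..<\<sigma>} \<Longrightarrow> run T S = S"
  obtains S where "length S = n" "set S \<subseteq> {..<\<sigma>}"
    "m * L * (\<sigma> - 3) \<le> num_queries T S" "z_no S \<le> k + 8 * m + 4"
proof -
  define q where "q = (\<sigma> - 2) ^ L"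
  \<comment> \<open>One more than the longest context run, which has \<open>m + 1\<close> zeros:
    long enough for \<open>dict\<close>, and never mistaken for a context.\<close>
  define M where "M = m + 2"
  define Y where "Y = {2..<\<sigma>}"
  define ws where "ws = List.n_lists L [2..<\<sigma>]"
  have len_ws: "length ws = q" by (simp add: ws_def length_n_lists q_def)
  have set_ws: "w \<in> set ws \<longleftrightarrow> length w = L \<and> set w \<subseteq> Y" for w
    by (auto simp: ws_def set_n_lists Y_def)
  have "2 ^ 1 \<le> q" unfolding q_def
    by (rule order.trans[OF power_increasing power_mono]) (use \<sigma> L in auto)
  moreover have m: "m = L * q" by (simp add: m_def q_def)
  ultimately have qm: "q \<le> m" "L \<le> m" "2 \<le> m" using L by (auto intro: order.trans[of 2 q])
  \<comment> \<open>The subtracted terms are the dictionary without its padding, the pairs of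
    context and word, and the last context.\<close>
  define R where "R = n - (q * (L + M + 2) + (\<Sum>i<m. i + 3 + L) + m + 3)"
  let ?D = "run_dict R M ws"
  let ?t = "slots ?D run_ctx L m"
  let ?F = "Pi ({..<m} \<times> {..<L}) (\<lambda>_. Y)"
  have len_ctx: "length (run_ctx i) = i + 3" for i by (simp add: run_ctx_def)
  have "(\<Sum>w\<leftarrow>ws. length w + Suc (Suc M)) = (\<Sum>w\<leftarrow>ws. L + Suc (Suc M))"
    using set_ws by (intro arg_cong[where f = sum_list] map_cong) auto
  then have len_D: "length ?D = R + q * (L + M + 2)"
    by (simp add: run_dict_def length_concat comp_def sum_list_triv len_ws)
  \<comment> \<open>The quadratic lower bound on \<open>n\<close> leaves at least
    \<open>m + 2\<close> zeros of padding, enough for unique contexts and as a source of all shorter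
    runs.\<close>
  have "m + 2 + (q * (L + M + 2) + (\<Sum>i<m. i + 3 + L) + m + 3) \<le> 10 * (m * m)"
  proof -
    have "q * (L + M + 2) \<le> m * (m + M + 2)" using qm by (intro mult_mono) auto
    moreover have "(\<Sum>i<m. i + 3 + L) \<le> (\<Sum>i<m. m + 2 + m)" using qm by (intro sum_mono) auto
    moreover have "2 * m \<le> m * m" "2 * 2 \<le> m * m"
      using mult_le_mono[OF qm(3) le_refl] mult_le_mono[OF qm(3) qm(3)] by blast+
    moreover have "m * (m + M + 2) = 2 * (m * m) + 4 * m" "(\<Sum>i<m. m + 2 + m) = 2 * (m * m) + 2 * m"
      by (simp_all add: M_def algebra_simps)
    ultimately show ?thesis by linarith
  qed
  then have R: "m + 2 \<le> R" and R': "R + (q * (L + M + 2) + (\<Sum>i<m. i + 3 + L) + m + 3) = n"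
    using n(1) by (auto simp: R_def)
  have len: "length ?t = n" using R' by (simp add: length_slots len_ctx len_D)
  have set: "set (fill ?t f) \<subseteq> {..<\<sigma>}" if "f \<in> ?F" for f
  proof (rule order.trans[OF set_fill_slots[OF that]])
    have "x < \<sigma>" if "w \<in> set ws" "x \<in> set w" for w x
      using that set_ws[of w] by (auto simp: Y_def)
    then show "set ?D \<union> (\<Union>i\<le>m. set (run_ctx i)) \<union> Y \<subseteq> {..<\<sigma>}"
      using \<sigma> by (auto simp: run_dict_def run_ctx_def Y_def)
  qed
  have dict: "sublist (tl (run_ctx i) @ w @ butlast (run_ctx (Suc i))) ?D"
    if "i < m" "length w = L" "set w \<subseteq> Y" for i w
  proof -
    have "butlast (run_ctx (Suc i)) = 1 # replicate (Suc (Suc i)) 0"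
      unfolding run_ctx_def by (subst append_Cons[symmetric], subst butlast_snoc) simp
    moreover have "tl (run_ctx i) = replicate (Suc i) 0 @ [1]" by (simp add: run_ctx_def)
    ultimately show ?thesis
      using sublist_run_dict[of w ws "Suc i" R M "Suc (Suc i)"] that R set_ws
      by (simp add: M_def)
  qed
  have "\<exists>f\<in>?F. m * L * (card Y - 1) \<le> num_queries T (fill ?t f)"
  proof (rule slots_num_queries)
    fix f f' i X Z X' Z'
    assume f: "f \<in> ?F" "f' \<in> ?F" and i: "i \<le> m"
      and eq: "fill ?t f = X @ run_ctx i @ Z" "fill ?t f' = X' @ run_ctx i @ Z'"
    have "length X = length ?D + (\<Sum>j<i. length (run_ctx j) + L)"
      if "f \<in> ?F" "fill ?t f = X @ run_ctx i @ Z" for f X Z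
      by (rule run_ctx_unique[where Y = Y, OF _ _ L i _ _ that])
        (use R set_ws in \<open>auto simp: M_def Y_def\<close>)
    then show "length X = length X'" using f eq by metis
  next
    show "run T (fill ?t f) = fill ?t f" if "f \<in> ?F" for f
      using T[OF _ set[OF that]] len by (simp add: length_fill)
  qed (use \<sigma> dict in \<open>auto simp: Y_def run_ctx_def\<close>)
  then obtain f where f: "f \<in> ?F" "m * L * (\<sigma> - 3) \<le> num_queries T (fill ?t f)"
    by (auto simp: Y_def)
  have "R \<le> 2 ^ k" using R' n(2) by linarith
  then have "lz_cover ?D (Suc k + q * (L + 3))"
    using lz_cover_run_dict[of R k M ws L] R set_ws len_ws by (simp add: M_def)
  \<comment> \<open>A context takes three phrases: a separator, a copied run and a
    separator.\<close>
  then have "lz_cover (fill ?t f) (Suc k + q * (L + 3) + m * Suc 3 + 3)"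
  proof (rule lz_cover_slots)
    fix i P' k' assume i: "i \<le> m" and P': "lz_cover P' k'" "prefix ?D P'"
    have "sublist (replicate (Suc i) 0) (replicate R 0)"
      using R i by (intro sublist_replicate) simp
    also have "sublist (replicate R 0) ?D" by (simp add: run_dict_def)
    also have "sublist ?D (P' @ [1])" using P'(2)
      by (meson prefix_imp_sublist sublist_append_rightI sublist_order.order.trans)
    finally have "lz_cover ((P' @ [1]) @ replicate (Suc i) 0) (Suc (Suc k'))"
      using P'(1) by (intro lz_cover.copy lz_cover.letter)
    from lz_cover.letter[OF this, of 1] show "lz_cover (P' @ run_ctx i) (k' + 3)"
      by (simp add: run_ctx_def eval_nat_numeral)
  next
    fix w assume "length w = L" "set w \<subseteq> Y"
    then have "sublist (replicate 0 0 @ 1 # w @ 1 # replicate 0 0) ?D"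
      using set_ws by (intro sublist_run_dict) auto
    moreover have "sublist w ([1] @ w @ [1])" by (rule sublist_appendI)
    ultimately show "sublist w ?D" using sublist_order.order.trans by fastforce
  qed (fact f)
  moreover have "Suc k + q * (L + 3) + m * Suc 3 + 3 \<le> k + 8 * m + 4"
    using qm(1) m by (simp add: algebra_simps)
  ultimately have "z_no (fill ?t f) \<le> k + 8 * m + 4"
    using z_no_le_lz_cover order.trans by blast
  then show thesis using that[of "fill ?t f"] f set len by (simp add: length_fill)
qed

section \<open>Alphabets of size two and three: counting binary words\<close>

text \<open>Distinct strings must end at distinct leaves, and each query at most doubles the number
  of leaves.\<close>

lemma card_le_num_queries:
  assumes "\<And>S. S \<in> F \<Longrightarrow> run T S = S" "\<And>S. S \<in> F \<Longrightarrow> num_queries T S \<le> d"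
  shows "finite F \<and> card F \<le> 2 ^ d"
  using assms
proof (induction T arbitrary: F d)
  case (Answer r)
  then have "F \<subseteq> {r}" by force
  then have "finite F" "card F \<le> 1" using finite_subset card_mono[of "{r}" F] by auto
  then show ?case by (meson one_le_numeral one_le_power order.trans)
next
  case (Ask s ty tn)
  show ?case
  proof (cases d)
    case 0
    then have "F = {}" using Ask.prems(2) by fastforce
    then show ?thesis by simp
  next
    case (Suc d')
    let ?Y = "{S \<in> F. sublist s S}" and ?N = "{S \<in> F. \<not> sublist s S}"
    have Y: "finite ?Y \<and> card ?Y \<le> 2 ^ d'"
      using Ask.prems Suc by (intro Ask.IH(1)) force+
    have N: "finite ?N \<and> card ?N \<le> 2 ^ d'"
      using Ask.prems Suc by (intro Ask.IH(2)) force+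
    have F: "F = ?Y \<union> ?N" by blast
    have "card F \<le> card ?Y + card ?N" by (subst F) (rule card_Un_le)
    moreover have "finite F" by (subst F) (use Y N in simp)
    ultimately show ?thesis using Y N Suc by simp
  qed
qed

text \<open>\<open>b\<close> is cut into \<open>m\<close> blocks of length \<open>L\<close>, each a
  single copy from \<open>P\<close>.\<close>

lemma lz_cover_words:
  assumes "lz_cover P k" "\<And>w. length w = L \<Longrightarrow> set w \<subseteq> Y \<Longrightarrow> sublist w P"
    and "length b = m * L" "set b \<subseteq> Y"
  shows "lz_cover (P @ b) (k + m)"
  using assms
proof (induction m arbitrary: P k b)
  case (Suc m)
  have "set (take L b) \<subseteq> Y" "set (drop L b) \<subseteq> Y"
    using Suc.prems(4) set_take_subset set_drop_subset by fast+
  moreover have "lz_cover (P @ take L b) (Suc k)"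
    using Suc.prems calculation(1) by (intro lz_cover.copy) auto
  moreover have "sublist w (P @ take L b)" if "length w = L" "set w \<subseteq> Y" for w
    using Suc.prems(2)[OF that] by (meson sublist_append_rightI sublist_order.order.trans)
  ultimately have "lz_cover ((P @ take L b) @ drop L b) (Suc k + m)"
    using Suc.prems(3) by (intro Suc.IH) auto
  then show ?case by simp
qed simp

text \<open>The tail \<open>b\<close> has \<open>m * L\<close> free bits, which forces that many
  queries on some string, yet it parses into \<open>m\<close> copies from the dictionary. The
  dictionary has \<open>m\<close> letters and so costs at most \<open>m\<close> phrases besides the
  padding.\<close>

lemma obtain_binary_words:
  fixes L n k :: nat
  defines "m \<equiv> L * 2 ^ L"
  assumes L: "0 < L" and n: "m + m * L \<le> n" "n \<le> 2 ^ k"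
    and T: "\<And>S. length S = n \<Longrightarrow> set S \<subseteq> {0, 1} \<Longrightarrow> run T S = S"
  obtains S where "length S = n" "set S \<subseteq> {0, 1}" "m * L \<le> num_queries T S"
    "z_no S \<le> k + 2 * m + 1"
proof -
  define R where "R = n - (m + m * L)"
  define ws where "ws = List.n_lists L [0, 1::nat]"
  define D where "D = replicate R 0 @ concat ws"
  define B where "B = {b. set b \<subseteq> {0, 1::nat} \<and> length b = m * L}"
  have set_ws: "w \<in> set ws \<longleftrightarrow> length w = L \<and> set w \<subseteq> {0, 1}" for w
    by (auto simp: ws_def set_n_lists)
  have "map length ws = map (\<lambda>_. L) ws" using set_ws by (intro map_cong) auto
  then have len_ws: "length (concat ws) = m"
    by (simp add: length_concat map_replicate_const sum_list_replicate ws_def length_n_lists m_def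
        numeral_2_eq_2)
  have len: "length (D @ b) = n" if "b \<in> B" for b
    using n(1) that len_ws by (simp add: D_def B_def R_def)
  have set: "set (D @ b) \<subseteq> {0, 1}" if "b \<in> B" for b
    using that set_ws by (fastforce simp: D_def B_def)
  obtain b where b: "b \<in> B" "m * L \<le> num_queries T (D @ b)"
  proof (rule ccontr)
    assume "\<not> thesis"
    then have less: "num_queries T (D @ b) < m * L" if "b \<in> B" for b
      using that \<open>\<And>b. _ \<Longrightarrow> _ \<Longrightarrow> thesis\<close> by (meson not_less)
    let ?F = "(\<lambda>b. D @ b) ` B"
    have mL: "0 < m * L" using L by (simp add: m_def)
    have "finite ?F \<and> card ?F \<le> 2 ^ (m * L - 1)"
    proof (rule card_le_num_queries)
      show "run T S = S" if "S \<in> ?F" for S using that T len set by blast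
      show "num_queries T S \<le> m * L - 1" if "S \<in> ?F" for S using that less by fastforce
    qed
    moreover have "card ?F = card B" by (rule card_image) (simp add: inj_on_def)
    moreover have "card B = 2 ^ (m * L)"
      unfolding B_def using card_lists_length_eq[of "{0, 1::nat}" "m * L"]
      by (simp add: numeral_2_eq_2)
    ultimately have "(2::nat) ^ (m * L) \<le> 2 ^ (m * L - 1)" by simp
    then have "m * L \<le> m * L - 1" by (rule power_le_imp_le_exp[rotated]) simp
    then show False using mL by linarith
  qed
  have "R \<le> 2 ^ k" using n by (simp add: R_def)
  then have "lz_cover D (Suc k + m)"
    using lz_cover_letters[OF lz_cover_replicate, of R k 0 "concat ws"] len_ws by (simp add: D_def)
  then have "lz_cover (D @ b) (Suc k + m + m)"
  proof (rule lz_cover_words)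
    show "sublist w D" if w: "length w = L" "set w \<subseteq> {0, 1}" for w
    proof -
      obtain A C where "ws = A @ w # C" using set_ws[of w] w split_list[of w ws] by blast
      then have "D = (replicate R 0 @ concat A) @ w @ concat C" by (simp add: D_def)
      then show ?thesis by (metis sublist_appendI)
    qed
  qed (use b in \<open>auto simp: B_def\<close>)
  then have "z_no (D @ b) \<le> k + 2 * m + 1" using z_no_le_lz_cover by fastforce
  then show thesis using that[of "D @ b"] b len set by blast
qed

section \<open>Choice of parameters in the three ranges\<close>

lemma log_le_of_le_power:
  fixes \<sigma> n p :: nat
  assumes "2 \<le> \<sigma>" "0 < n" "n \<le> \<sigma> ^ p"
  shows "log (real \<sigma>) (real n) \<le> real p"
proof -
  have "real n \<le> real \<sigma> ^ p" using assms(3) by (simp flip: of_nat_power)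
  then have "log (real \<sigma>) (real n) \<le> log (real \<sigma>) (real \<sigma> ^ p)"
    using assms by (subst log_le_cancel_iff) auto
  also have "\<dots> = real p" using assms by (simp add: log_nat_power)
  finally show ?thesis .
qed

text \<open>The crude bound \<sigma> \<le> \<open>2 ^ \<sigma>\<close> is enough, as the cost of the
  padding only has to stay below the order of the slots.\<close>

lemma le_power_2_of_le_power:
  fixes \<sigma> n p :: nat
  assumes "n \<le> \<sigma> ^ p"
  shows "n \<le> 2 ^ (\<sigma> * p)"
proof -
  have "\<sigma> ^ p \<le> (2 ^ \<sigma>) ^ p" by (intro power_mono) (auto intro: less_imp_le)
  then show ?thesis using assms by (simp add: power_mult)
qed

text \<open>An integer \<open>p\<close> above the logarithm turns each case into an inequality of
  natural numbers.\<close>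

lemma mult_log_le:
  fixes \<sigma> z n p Q :: nat
  assumes "2 \<le> \<sigma>" "0 < n" "n \<le> \<sigma> ^ p" "\<sigma> * z * p \<le> 10000 * Q"
  shows "1 / 10000 * real \<sigma> * real z * log (real \<sigma>) (real n) \<le> real Q"
proof -
  have "real \<sigma> * real z * log (real \<sigma>) (real n) \<le> real \<sigma> * real z * real p"
    using log_le_of_le_power[OF assms(1-3)] by (intro mult_left_mono) auto
  also have "\<dots> = real (\<sigma> * z * p)" by simp
  also have "\<dots> \<le> real (10000 * Q)" using assms(4) by (rule of_nat_mono)
  finally show ?thesis by simp
qed

lemma binary_case:
  fixes \<sigma> n :: nat
  assumes \<sigma>: "2 \<le> \<sigma>" "\<sigma> \<le> 3" and n: "16 \<le> n"
    and T: "\<And>S. length S = n \<Longrightarrow> set S \<subseteq> {..<\<sigma>} \<Longrightarrow> run T S = S"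
  shows "\<exists>S. length S = n \<and> set S \<subseteq> {..<\<sigma>} \<and>
    1 / 10000 * real \<sigma> * real (z_no S) * log (real \<sigma>) (real n) \<le> real (num_queries T S)"
proof -
  \<comment> \<open>Base 16 leaves room for the dictionary and the free bits, which together have
    length at most \<open>8 ^ L\<close>.\<close>
  obtain L where L: "16 ^ L \<le> n" "n < 16 ^ (L + 1)"
    using ex_power_ivl1[of 16 n] n by auto
  have L0: "0 < L" using L n by (cases L) auto
  define m where "m = L * 2 ^ L"
  have "L < 2 ^ L" by (rule less_exp)
  then have "L * 2 ^ L * (L + 1) \<le> 2 ^ L * 2 ^ L * 2 ^ L"
    by (intro mult_mono) (simp_all add: Suc_le_eq)
  also have "\<dots> = (8::nat) ^ L" by (simp flip: power_mult_distrib)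
  also have "\<dots> \<le> 16 ^ L" by (rule power_mono) auto
  finally have len: "m + m * L \<le> n" using L(1) by (simp add: m_def algebra_simps)
  have "(16::nat) ^ (L + 1) \<le> 16 ^ (2 * L)" using L0 by (intro power_increasing) auto
  also have "\<dots> = (2 ^ 4) ^ (2 * L)" by simp
  also have "\<dots> = 2 ^ (8 * L)" by (simp only: power_mult[symmetric]) simp
  finally have n2: "n \<le> 2 ^ (8 * L)" using L(2) by simp
  have run: "run T S = S" if "length S = n" "set S \<subseteq> {0, 1}" for S
    using that \<sigma> by (intro T) auto
  obtain S where S: "length S = n" "set S \<subseteq> {0, 1}" "m * L \<le> num_queries T S"
    "z_no S \<le> 8 * L + 2 * m + 1"
    using obtain_binary_words[OF L0 len[unfolded m_def] n2 run] unfolding m_def by blast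
  have "2 ^ 1 \<le> (2::nat) ^ L" using L0 by (intro power_increasing) auto
  then have "L * 2 \<le> m" unfolding m_def by (intro mult_left_mono) auto
  then have "z_no S \<le> 7 * m" using S(4) L0 by linarith
  then have "\<sigma> * z_no S * (8 * L) \<le> 3 * (7 * m) * (8 * L)" using \<sigma> by (intro mult_mono) auto
  also have "\<dots> \<le> 10000 * (m * L)" by simp
  finally have "\<sigma> * z_no S * (8 * L) \<le> 10000 * num_queries T S" using S(3) by linarith
  moreover have "n \<le> \<sigma> ^ (8 * L)"
    using n2 \<sigma>(1) by (meson order.trans power_mono zero_le)
  ultimately show ?thesis using S(1,2) \<sigma> n mult_log_le[of \<sigma> n "8 * L" "z_no S"]
    by (intro exI[of _ S]) auto
qed

lemma small_alphabet_case:
  fixes \<sigma> n :: nat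
  assumes \<sigma>: "4 \<le> \<sigma>" and n: "\<sigma> ^ 7 \<le> n"
    and T: "\<And>S. length S = n \<Longrightarrow> set S \<subseteq> {..<\<sigma>} \<Longrightarrow> run T S = S"
  shows "\<exists>S. length S = n \<and> set S \<subseteq> {..<\<sigma>} \<and>
    1 / 10000 * real \<sigma> * real (z_no S) * log (real \<sigma>) (real n) \<le> real (num_queries T S)"
proof -
  have n0: "0 < n" using \<sigma> n by (metis gr0I le_zero_eq not_numeral_le_zero power_not_zero)
  have "2 \<le> \<sigma> ^ 7" using \<sigma> self_le_power[of \<sigma> 7] by simp
  \<comment> \<open>The exponent 7 is 4 + 3: \<open>m * m\<close> is at most
    \<open>\<sigma> ^ (4 * L)\<close>, and the factor 10 is below
    \<open>\<sigma> ^ (3 * L)\<close>.\<close>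
  then obtain L where L: "(\<sigma> ^ 7) ^ L \<le> n" "n < (\<sigma> ^ 7) ^ (L + 1)"
    using ex_power_ivl1[of "\<sigma> ^ 7" n] n0 by auto
  have L0: "0 < L" using L n by (cases L) auto
  define m where "m = L * (\<sigma> - 2) ^ L"
  have "L \<le> 2 ^ L" by (rule less_imp_le[OF less_exp])
  also have "2 ^ L \<le> \<sigma> ^ L" using \<sigma> by (intro power_mono) auto
  finally have "m \<le> \<sigma> ^ L * \<sigma> ^ L" unfolding m_def by (intro mult_mono power_mono) auto
  then have "m * m \<le> (\<sigma> ^ L * \<sigma> ^ L) * (\<sigma> ^ L * \<sigma> ^ L)" by (intro mult_mono) auto
  also have "\<dots> = \<sigma> ^ (4 * L)"
    unfolding power_add[symmetric] by (rule arg_cong) simp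
  finally have mm: "m * m \<le> \<sigma> ^ (4 * L)" .
  have "(10::nat) \<le> 4 ^ 3" by simp
  also have "\<dots> \<le> \<sigma> ^ 3" using \<sigma> by (intro power_mono) auto
  also have "\<dots> \<le> \<sigma> ^ (3 * L)" using \<sigma> L0 by (intro power_increasing) auto
  finally have "10 * (m * m) \<le> \<sigma> ^ (3 * L) * \<sigma> ^ (4 * L)" using mm by (rule mult_mono) auto
  also have "\<dots> = (\<sigma> ^ 7) ^ L" by (simp flip: power_add power_mult)
  finally have len: "10 * (m * m) \<le> n" using L(1) by simp
  have "(\<sigma> ^ 7) ^ (L + 1) \<le> \<sigma> ^ (14 * L)"
    unfolding power_mult[symmetric] using \<sigma> L0 by (intro power_increasing) auto
  then have n\<sigma>: "n \<le> \<sigma> ^ (14 * L)" using L(2) by simp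
  obtain S where S: "length S = n" "set S \<subseteq> {..<\<sigma>}" "m * L * (\<sigma> - 3) \<le> num_queries T S"
    "z_no S \<le> \<sigma> * (14 * L) + 8 * m + 4"
    using obtain_run_contexts[OF \<sigma> L0 len[unfolded m_def] le_power_2_of_le_power[OF n\<sigma>] T]
    unfolding m_def by blast
  have "(\<sigma> - 2) ^ 1 \<le> (\<sigma> - 2) ^ L" using \<sigma> L0 by (intro power_increasing) auto
  then have "L * (\<sigma> - 2) \<le> m" unfolding m_def by (intro mult_left_mono) auto
  moreover have "\<sigma> * L \<le> 2 * (L * (\<sigma> - 2))"
  proof -
    have "\<sigma> \<le> 2 * (\<sigma> - 2)" using \<sigma> by linarith
    from mult_le_mono1[OF this, of L] show ?thesis by (simp add: mult_ac)
  qed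
  moreover have "1 * 2 \<le> L * (\<sigma> - 2)" using \<sigma> L0 by (intro mult_mono) auto
  ultimately have "z_no S \<le> 40 * m" using S(4) by linarith
  \<comment> \<open>From 4 \<le> \<sigma> follows \<sigma> \<le> \<open>4 * (\<sigma> - 3)\<close>,
    so the loss of three letters costs only a constant factor.\<close>
  then have "\<sigma> * z_no S * (14 * L) \<le> (4 * (\<sigma> - 3)) * (40 * m) * (14 * L)"
    using \<sigma> by (intro mult_mono) auto
  also have "\<dots> \<le> 10000 * (m * L * (\<sigma> - 3))" by (simp add: algebra_simps)
  finally have "\<sigma> * z_no S * (14 * L) \<le> 10000 * num_queries T S" using S(3) by linarith
  then show ?thesis using S(1,2) \<sigma> n0 n\<sigma> mult_log_le[of \<sigma> n "14 * L" "z_no S"]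
    by (intro exI[of _ S]) auto
qed

lemma large_alphabet_case:
  fixes \<sigma> n :: nat
  assumes \<sigma>: "8 \<le> \<sigma>" and n: "\<sigma> \<le> n" "n \<le> \<sigma> ^ 7"
    and T: "\<And>S. length S = n \<Longrightarrow> set S \<subseteq> {..<\<sigma>} \<Longrightarrow> run T S = S"
  shows "\<exists>S. length S = n \<and> set S \<subseteq> {..<\<sigma>} \<and>
    1 / 10000 * real \<sigma> * real (z_no S) * log (real \<sigma>) (real n) \<le> real (num_queries T S)"
proof -
  \<comment> \<open>With a quarter of the alphabet, the letters up to \<open>2 * h + 1\<close> are
    available and the text fits into length \<open>n\<close>; 8 \<le> \<sigma> gives 2 \<le>
    \<open>h\<close>, so \<open>h - 1\<close> is still of order \<sigma>.\<close>
  define h where "h = \<sigma> div 4"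
  have h: "2 \<le> h" "\<sigma> \<le> 6 * h" "4 * h \<le> \<sigma>" using \<sigma> by (auto simp: h_def)
  have sub: "{..2 * h + 1} \<subseteq> {..<\<sigma>}" using h by auto
  have run: "run T S = S" if "length S = n" "set S \<subseteq> {..2 * h + 1}" for S
    using that sub by (intro T) auto
  have len: "0 < h" "3 * h + 1 \<le> n" using h n(1) by auto
  obtain S where S: "length S = n" "set S \<subseteq> {..2 * h + 1}" "h * (h - 1) \<le> num_queries T S"
    "z_no S \<le> \<sigma> * 7 + 3 * h + 2"
    using obtain_letter_contexts[OF len le_power_2_of_le_power[OF n(2)] run] by blast
  have "z_no S \<le> 46 * h" using S(4) h by linarith
  then have "\<sigma> * z_no S * 7 \<le> (6 * (2 * (h - 1))) * (46 * h) * 7" if "\<sigma> \<le> 6 * (2 * (h - 1))"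
    using that by (intro mult_mono) auto
  moreover have "\<sigma> \<le> 6 * (2 * (h - 1))" using h by simp
  moreover have "(6 * (2 * (h - 1))) * (46 * h) * 7 \<le> 10000 * (h * (h - 1))"
    by (simp add: algebra_simps)
  ultimately have "\<sigma> * z_no S * 7 \<le> 10000 * num_queries T S" using S(3) by linarith
  then show ?thesis using S(1,2) \<sigma> n sub mult_log_le[of \<sigma> n 7 "z_no S"]
    by (intro exI[of _ S]) auto
qed

theorem theorem3:
  shows "\<exists>c::real. c > 0 \<and> (\<exists>N::nat. \<forall>(\<sigma>::nat) (n::nat) (T::qtree).
     2 \<le> \<sigma> \<longrightarrow> \<sigma> \<le> n \<longrightarrow> N \<le> n \<longrightarrow>
     (\<forall>S. length S = n \<and> set S \<subseteq> {..<\<sigma>} \<longrightarrow> run T S = S) \<longrightarrow>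
     (\<exists>S. length S = n \<and> set S \<subseteq> {..<\<sigma>} \<and>
          real (num_queries T S) \<ge> c * real \<sigma> * real (z_no S) * log (real \<sigma>) (real n)))"
proof (intro exI[of _ "1 / 10000 :: real"] conjI exI[of _ "8 ^ 7 :: nat"] allI impI)
  fix \<sigma> n :: nat and T :: qtree
  assume \<sigma>: "2 \<le> \<sigma>" "\<sigma> \<le> n" and n: "8 ^ 7 \<le> n"
    and "\<forall>S. length S = n \<and> set S \<subseteq> {..<\<sigma>} \<longrightarrow> run T S = S"
  then have T: "run T S = S" if "length S = n" "set S \<subseteq> {..<\<sigma>}" for S using that by blast
  consider "\<sigma> \<le> 3" | "4 \<le> \<sigma>" "\<sigma> ^ 7 \<le> n" | "n < \<sigma> ^ 7" by linarith
  then show "\<exists>S. length S = n \<and> set S \<subseteq> {..<\<sigma>} \<and>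
    1 / 10000 * real \<sigma> * real (z_no S) * log (real \<sigma>) (real n) \<le> real (num_queries T S)"
  proof cases
    case 1
    then show ?thesis using binary_case[OF \<sigma>(1) 1 _ T] n by simp
  next
    case 2
    then show ?thesis using small_alphabet_case[OF 2 T] by simp
  next
    case 3
    \<comment> \<open>Here the threshold \<open>8 ^ 7\<close> on \<open>n\<close> matters: a text
      shorter than \<open>\<sigma> ^ 7\<close> forces the alphabet to have at least 8
      letters.\<close>
    then have "8 ^ 7 < \<sigma> ^ 7" using n by linarith
    then have "8 \<le> \<sigma>" by (meson less_imp_le power_less_imp_less_base zero_le)
    then show ?thesis using large_alphabet_case[OF _ \<sigma>(2) less_imp_le[OF 3] T] by simp
  qed
qed simp

end
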